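(* Consider the problem $$\underset{\mathbf{x}\in\mathcal{X},\ \mathbf{z}\in\mathcal{Z}}{\text{minimize}}\ f(\mathbf{x})+g(\mathbf{z})\quad\text{subject to}\quad \mathbf{A}\mathbf{x}+\mathbf{B}\mathbf{z}=\mathbf{c},$$ where $\mathcal{X}\subset\mathbb{R}^{p_1}$, $\mathcal{Z}\subset\mathbb{R}^{p_2}$, $\mathbf{A}\in\mathbb{R}^{q\times p_1}$, $\mathbf{B}\in\mathbb{R}^{q\times p_2}$, $\mathbf{c}\in\mathbb{R}^q$, and assume the problem is feasible. Suppose that: 1. $f$ and $g$ are continuously differentiable (on $\mathbb{R}^{p_1}$ and $\mathbb{R}^{p_2}$; not necessarily convex); 2. $\mathcal{X}$ and $\mathcal{Z}$ are convex and compact; 3. Slater's condition holds individually for $\mathcal{X}$ and $\mathcal{Z}$: there exists $\mathbf{x}\in\mathcal{X}$ (respectively $\mathbf{z}\in\mathcal{Z}$) at which all the inequality constraints characterizing $\mathcal{X}$ (respectively $\mathcal{Z}$) are inactive; 4. $\mathbf{A}$ and $\mathbf{B}$ have full column rank. Let $\{(\mathbf{x}(t),\mathbf{z}(t))\}$ be generated by the Alternating Direction Penalty Method (ADPM) with a bounded sequence of multiplier vectors $\{\mathbf{y}(t)\}_{t\in\mathbb{N}}\subset\mathbb{R}^q$ and with penalty parameters $\rho(t)>0$ such that $\rho(t+1)\ge\rho(t)$ for all $t$ and such that there exist an integer $\kappa>0$ and a scalar $\Delta>1$ with $\rho(t+\kappa)\ge\Delta\rho(t)$ for all $t$. Let $r(t)=\|\mathbf{A}\mathbf{x}(t)+\mathbf{B}\mathbf{z}(t)-\mathbf{c}\|$.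 Then $\lim_{t\to\infty}r(t)=0$.
   Context: ADPM: with the augmented Lagrangian $$L_\rho(\mathbf{x},\mathbf{z},\mathbf{y})=f(\mathbf{x})+g(\mathbf{z})+\mathbf{y}^{T}(\mathbf{A}\mathbf{x}+\mathbf{B}\mathbf{z}-\mathbf{c})+\tfrac{\rho}{2}\|\mathbf{A}\mathbf{x}+\mathbf{B}\mathbf{z}-\mathbf{c}\|^2,$$ starting from an initial $\mathbf{z}(0)$, for $t=0,1,2,\dots$ the method computes $\mathbf{x}(t+1)\in\operatorname{argmin}_{\mathbf{x}\in\mathcal{X}}L_{\rho(t)}(\mathbf{x},\mathbf{z}(t),\mathbf{y}(t))$ and then $\mathbf{z}(t+1)\in\operatorname{argmin}_{\mathbf{z}\in\mathcal{Z}}L_{\rho(t)}(\mathbf{x}(t+1),\mathbf{z},\mathbf{y}(t))$ (global minimizers). The sequences $\rho(t)$ and $\mathbf{y}(t)$ are parameters chosen by the user. $\|\cdot\|$ is the Euclidean 2-norm. The sets $\mathcal{X}$, $\mathcal{Z}$ are understood to be given through finitely many equality and inequality constraints (to which Slater's condition refers). *)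

theory Defs
  imports "HOL-Analysis.Analysis"
begin

definition continuously_differentiable :: "('a::real_inner \<Rightarrow> real) \<Rightarrow> bool" where
  "continuously_differentiable f \<longleftrightarrow>
     (\<exists>f'. (\<forall>x. GDERIV f x :> f' x) \<and> continuous_on UNIV f')"

text \<open>
  A constraint system consists of a set \<open>I\<close> of inequality constraints
  \<open>\<phi> x \<le> 0\<close> and a set \<open>E\<close> of equality constraints \<open>\<psi> x = 0\<close>.
\<close>

definition constraint_set :: "('a \<Rightarrow> real) set \<Rightarrow> ('a \<Rightarrow> real) set \<Rightarrow> 'a set" where
  "constraint_set I E = {x. (\<forall>\<phi>\<in>I. \<phi> x \<le> 0) \<and> (\<forall>\<psi>\<in>E. \<psi> x = 0)}"

definition slater :: "('a \<Rightarrow> real) set \<Rightarrow> ('a \<Rightarrow> real) set \<Rightarrow> bool" where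
  "slater I E \<longleftrightarrow> (\<exists>x\<in>constraint_set I E. \<forall>\<phi>\<in>I. \<phi> x < 0)"

definition full_column_rank :: "real^'n^'m \<Rightarrow> bool" where
  "full_column_rank A \<longleftrightarrow> rank A = CARD('n)"

definition aug_lagrangian ::
  "(real^'p1 \<Rightarrow> real) \<Rightarrow> (real^'p2 \<Rightarrow> real) \<Rightarrow> real^'p1^'q \<Rightarrow> real^'p2^'q \<Rightarrow> real^'q \<Rightarrow>
     real \<Rightarrow> real^'p1 \<Rightarrow> real^'p2 \<Rightarrow> real^'q \<Rightarrow> real" where
  "aug_lagrangian f g A B c \<rho> x z y =
     f x + g z + y \<bullet> (A *v x + B *v z - c) + \<rho> / 2 * (norm (A *v x + B *v z - c))\<^sup>2"

text \<open>
  The method starts from \<open>z 0\<close>; the value \<open>x 0\<close> is never used and is left arbitrary.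
\<close>

definition adpm ::
  "(real^'p1 \<Rightarrow> real) \<Rightarrow> (real^'p2 \<Rightarrow> real) \<Rightarrow> real^'p1^'q \<Rightarrow> real^'p2^'q \<Rightarrow> real^'q \<Rightarrow>
     (real^'p1) set \<Rightarrow> (real^'p2) set \<Rightarrow> (nat \<Rightarrow> real) \<Rightarrow> (nat \<Rightarrow> real^'q) \<Rightarrow>
     (nat \<Rightarrow> real^'p1) \<Rightarrow> (nat \<Rightarrow> real^'p2) \<Rightarrow> bool" where
  "adpm f g A B c X Z \<rho> y x z \<longleftrightarrow>
     (\<forall>t. is_arg_min (\<lambda>u. aug_lagrangian f g A B c (\<rho> t) u (z t) (y t)) (\<lambda>u. u \<in> X) (x (Suc t)) \<and>
          is_arg_min (\<lambda>v. aug_lagrangian f g A B c (\<rho> t) (x (Suc t)) v (y t)) (\<lambda>v. v \<in> Z) (z (Suc t)))"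

end

theory Submission
  imports Defs
begin

text \<open>
  Let \<open>(p, q)\<close> be feasible and \<open>V t = \<parallel>B z(t) - B q\<parallel>\<^sup>2\<close>. Up to an error of order \<open>1/\<rho>(t)\<close>,
  the first-order optimality conditions of the two minimizations are those of projections onto the
  convex sets \<open>A X\<close> and \<open>c - B Z\<close>, which meet in \<open>A p = c - B q\<close>. By the Pythagorean inequality for
  projections, \<open>r(t+1)\<^sup>2 \<le> V t - V (t+1) + E/\<rho>(t)\<close>. Since \<open>1/\<rho>\<close> decays geometrically over blocks
  of length \<open>\<kappa>\<close> it is summable, hence so is \<open>r\<^sup>2\<close>.
\<close>

text \<open>If the slope towards \<open>v\<close> were negative, \<open>f\<close> would strictly
  decrease when leaving \<open>u\<close> along the segment to \<open>v\<close>, and by convexity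
  this segment stays in \<open>S\<close>.\<close>

lemma has_derivative_nonneg_at_convex_min:
  fixes f :: "'a::real_normed_vector \<Rightarrow> real"
  assumes "(f has_derivative f') (at u)" "convex S" "u \<in> S" "v \<in> S"
    and min: "\<And>w. w \<in> S \<Longrightarrow> f u \<le> f w"
  shows "0 \<le> f' (v - u)"
proof (rule ccontr)
  assume neg: "\<not> 0 \<le> f' (v - u)"
  define h where "h s = f (u + s *\<^sub>R (v - u))" for s :: real
  have lin: "linear f'"
    using assms(1) by (rule has_derivative_linear)
  have "((\<lambda>s. u + s *\<^sub>R (v - u)) has_derivative (\<lambda>s. s *\<^sub>R (v - u))) (at 0)"
    by (auto intro!: derivative_eq_intros)
  moreover have "(f has_derivative f') (at (u + 0 *\<^sub>R (v - u)))"
    using assms(1) by simp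
  ultimately have "(h has_derivative (\<lambda>s. f' (s *\<^sub>R (v - u)))) (at 0)"
    unfolding h_def by (rule has_derivative_compose)
  then have "(h has_real_derivative f' (v - u)) (at 0)"
    by (simp add: has_field_derivative_def linear_cmul[OF lin] mult_commute_abs)
  from has_real_derivative_neg_dec_right[OF this] neg
  obtain d where d: "d > 0" "\<And>s. 0 < s \<Longrightarrow> s < d \<Longrightarrow> h s < h 0"
    by auto
  \<comment> \<open>The cap \<open>1\<close> keeps the point on the segment, and
    \<open>d / 2\<close> keeps it where \<open>h\<close> lies below \<open>h 0\<close>.\<close>
  define s where "s = min 1 (d / 2)"
  have s: "0 < s" "s < d" "s \<le> 1"
    using d(1) by (auto simp: s_def)
  have "(1 - s) *\<^sub>R u + s *\<^sub>R v \<in> S"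
    using assms s by (intro convexD) auto
  moreover have "(1 - s) *\<^sub>R u + s *\<^sub>R v = u + s *\<^sub>R (v - u)"
    by (simp add: algebra_simps)
  ultimately have "f u \<le> h s"
    using min by (simp add: h_def)
  with d(2)[OF s(1,2)] show False
    by (simp add: h_def)
qed

text \<open>The right-hand side is the derivative at \<open>u\<close>, in the direction
  \<open>p - u\<close>, of the objective of one block update; \<open>b\<close> absorbs the block
  held fixed.\<close>

lemma penalty_min_first_order:
  fixes f :: "'a::real_inner \<Rightarrow> real" and K :: "'a \<Rightarrow> 'b::real_inner"
  assumes "GDERIV f u :> d" "bounded_linear K" "convex S" "u \<in> S" "p \<in> S"
    and min: "\<And>v. v \<in> S \<Longrightarrow> f u + l \<bullet> (K u - b) + \<rho> / 2 * (norm (K u - b))\<^sup>2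
                         \<le> f v + l \<bullet> (K v - b) + \<rho> / 2 * (norm (K v - b))\<^sup>2"
  shows "0 \<le> (p - u) \<bullet> d + l \<bullet> K (p - u) + \<rho> * ((K u - b) \<bullet> K (p - u))"
proof -
  have K: "(K has_derivative K) (at u)"
    using assms(2) by (rule bounded_linear_imp_has_derivative)
  have f: "(f has_derivative (\<lambda>h. h \<bullet> d)) (at u)"
    using assms(1) by (simp add: gderiv_def)
  \<comment> \<open>The squared norm is written as an inner product so that the product rule
    applies; its factor 2 cancels the one in \<open>\<rho> / 2\<close>.\<close>
  have "((\<lambda>v. f v + l \<bullet> (K v - b) + \<rho> / 2 * ((K v - b) \<bullet> (K v - b))) has_derivative
      (\<lambda>h. h \<bullet> d + l \<bullet> K h + \<rho> * ((K u - b) \<bullet> K h))) (at u)"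
    by (rule derivative_eq_intros f K refl)+ (simp add: fun_eq_iff inner_commute)
  from has_derivative_nonneg_at_convex_min[OF this assms(3-5)] min
  show ?thesis
    by (simp add: power2_norm_eq_inner)
qed

text \<open>Dividing the first-order condition by \<open>\<rho>\<close> shows that the angle at
  \<open>K u\<close> between \<open>b\<close> and \<open>K p\<close> is obtuse or right up to an
  error \<open>C / \<rho>\<close>; the law of cosines does the rest. For \<open>C = 0\<close> this
  is the inequality for the projection of \<open>b\<close> onto the image of
  \<open>S\<close>.\<close>

lemma penalty_min_pythagoras:
  fixes f :: "'a::real_inner \<Rightarrow> real" and K :: "'a \<Rightarrow> 'b::real_inner"
  assumes "GDERIV f u :> d" "bounded_linear K" "convex S" "u \<in> S" "p \<in> S" "\<rho> > 0"
    and "\<And>v. v \<in> S \<Longrightarrow> f u + l \<bullet> (K u - b) + \<rho> / 2 * (norm (K u - b))\<^sup>2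
                     \<le> f v + l \<bullet> (K v - b) + \<rho> / 2 * (norm (K v - b))\<^sup>2"
    and C: "(p - u) \<bullet> d + l \<bullet> K (p - u) \<le> C"
  shows "(norm (K u - b))\<^sup>2 + (norm (K u - K p))\<^sup>2 \<le> (norm (K p - b))\<^sup>2 + 2 * C / \<rho>"
proof -
  have "0 \<le> C + \<rho> * ((K u - b) \<bullet> K (p - u))"
    using penalty_min_first_order[OF assms(1-5,7)] C by linarith
  then have "- ((K u - b) \<bullet> (K p - K u)) \<le> C / \<rho>"
    using \<open>\<rho> > 0\<close> bounded_linear.linear[OF assms(2)]
    by (simp add: linear_diff field_simps)
  moreover have "(norm (K p - b))\<^sup>2
      = (norm (K u - b))\<^sup>2 + (norm (K u - K p))\<^sup>2 + 2 * ((K u - b) \<bullet> (K p - K u))"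
    by (simp add: power2_norm_eq_inner inner_diff_left inner_diff_right inner_commute)
  ultimately show ?thesis
    by simp
qed

text \<open>Supplies one \<open>C\<close> for all iterates and all multipliers: compactness bounds
  the factors depending on \<open>u\<close>, and Cauchy-Schwarz handles \<open>y t\<close>.\<close>

lemma first_order_term_bounded:
  fixes f' :: "'a::real_inner \<Rightarrow> 'a" and K :: "'a \<Rightarrow> 'b::real_inner" and y :: "'i \<Rightarrow> 'b"
  assumes "compact S" "continuous_on S f'" "bounded_linear K" "bounded (range y)"
  obtains C where "\<And>u t. u \<in> S \<Longrightarrow> (p - u) \<bullet> f' u + y t \<bullet> K (p - u) \<le> C"
proof -
  have "continuous_on S (\<lambda>u. (p - u) \<bullet> f' u)"
    using assms by (intro continuous_intros)
  then have "bounded ((\<lambda>u. (p - u) \<bullet> f' u) ` S)"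
    using assms(1) by (intro compact_imp_bounded compact_continuous_image)
  then obtain C1 where C1: "\<And>u. u \<in> S \<Longrightarrow> \<bar>(p - u) \<bullet> f' u\<bar> \<le> C1"
    by (auto simp: bounded_iff)
  have "continuous_on S (\<lambda>u. K (p - u))"
    by (intro bounded_linear.continuous_on[OF assms(3)] continuous_intros)
  then have "bounded ((\<lambda>u. K (p - u)) ` S)"
    using assms(1) by (intro compact_imp_bounded compact_continuous_image)
  then obtain C2 where C2: "\<And>u. u \<in> S \<Longrightarrow> norm (K (p - u)) \<le> C2"
    by (auto simp: bounded_iff)
  obtain C3 where C3: "\<And>t. norm (y t) \<le> C3"
    using assms(4) by (auto simp: bounded_iff)
  have "(p - u) \<bullet> f' u + y t \<bullet> K (p - u) \<le> C1 + C3 * C2" if "u \<in> S" for u t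
  proof -
    have "y t \<bullet> K (p - u) \<le> norm (y t) * norm (K (p - u))"
      by (rule norm_cauchy_schwarz)
    also have "\<dots> \<le> C3 * C2"
      using C2[OF that] C3 order_trans[OF norm_ge_zero C3] by (intro mult_mono) auto
    finally show ?thesis
      using C1[OF that] by linarith
  qed
  then show ?thesis ..
qed

text \<open>Shifting by \<open>k\<close> costs only the first \<open>k\<close> terms, so a partial
  sum \<open>s\<close> satisfies \<open>s \<le> sum h {..<k} + q * s\<close>, which is solved for
  \<open>s\<close>.\<close>

lemma summable_block_contraction:
  fixes h :: "nat \<Rightarrow> real"
  assumes nonneg: "\<And>t. 0 \<le> h t" and "q < 1" and h: "\<And>t. h (t + k) \<le> q * h t"
  shows "summable h"
proof (rule summableI_nonneg_bounded)
  fix n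
  have "sum h {..<n} \<le> sum h {..<n + k}"
    by (intro sum_mono2) (auto simp: nonneg)
  also have "\<dots> = sum h {..<k} + (\<Sum>t<n. h (t + k))"
    by (induction n) simp_all
  also have "(\<Sum>t<n. h (t + k)) \<le> q * sum h {..<n}"
    unfolding sum_distrib_left by (intro sum_mono h)
  finally show "sum h {..<n} \<le> sum h {..<k} / (1 - q)"
    using \<open>q < 1\<close> by (simp add: field_simps)
qed (rule nonneg)

text \<open>\<open>V\<close> acts as a Lyapunov function: the decreases telescope to at most
  \<open>V 0\<close>, and the errors add at most \<open>suminf e\<close>.\<close>

lemma summable_telescope_bound:
  fixes a V e :: "nat \<Rightarrow> real"
  assumes "\<And>t. 0 \<le> a t" "\<And>t. 0 \<le> V t" "\<And>t. 0 \<le> e t" "summable e"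
    and step: "\<And>t. a t \<le> V t - V (Suc t) + e t"
  shows "summable a"
proof (rule summableI_nonneg_bounded)
  fix n
  have "sum a {..<n} \<le> (\<Sum>t<n. V t - V (Suc t) + e t)"
    by (intro sum_mono step)
  also have "\<dots> = V 0 - V n + sum e {..<n}"
    by (simp add: sum.distrib sum_lessThan_telescope')
  also have "\<dots> \<le> V 0 + suminf e"
    using assms(2)[of n] sum_le_suminf[OF assms(4), of "{..<n}"] assms(3) by auto
  finally show "sum a {..<n} \<le> V 0 + suminf e" .
qed (rule assms(1))

theorem proposition2:
  fixes f :: "real^'p1 \<Rightarrow> real" and g :: "real^'p2 \<Rightarrow> real"
    and A :: "real^'p1^'q" and B :: "real^'p2^'q" and c :: "real^'q"
    and X :: "(real^'p1) set" and Z :: "(real^'p2) set"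
    and I\<^sub>X E\<^sub>X :: "(real^'p1 \<Rightarrow> real) set" and I\<^sub>Z E\<^sub>Z :: "(real^'p2 \<Rightarrow> real) set"
    and \<rho> :: "nat \<Rightarrow> real" and y :: "nat \<Rightarrow> real^'q"
    and x :: "nat \<Rightarrow> real^'p1" and z :: "nat \<Rightarrow> real^'p2"
    and \<kappa> :: nat and \<Delta> :: real
  assumes "finite I\<^sub>X" and "finite E\<^sub>X" and "X = constraint_set I\<^sub>X E\<^sub>X"
    and "finite I\<^sub>Z" and "finite E\<^sub>Z" and "Z = constraint_set I\<^sub>Z E\<^sub>Z"
    and feasible: "\<exists>u\<in>X. \<exists>v\<in>Z. A *v u + B *v v = c"
    and "continuously_differentiable f" and "continuously_differentiable g"
    and "convex X" and "compact X" and "convex Z" and "compact Z"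
    and "slater I\<^sub>X E\<^sub>X" and "slater I\<^sub>Z E\<^sub>Z"
    and "full_column_rank A" and "full_column_rank B"
    and "adpm f g A B c X Z \<rho> y x z"
    and "bounded (range y)"
    and "\<And>t. \<rho> t > 0" and "\<And>t. \<rho> (t + 1) \<ge> \<rho> t"
    and "\<kappa> > 0" and "\<Delta> > 1" and "\<And>t. \<rho> (t + \<kappa>) \<ge> \<Delta> * \<rho> t"
  shows "(\<lambda>t. norm (A *v x t + B *v z t - c)) \<longlonglongrightarrow> 0"
proof -
  obtain p q where p: "p \<in> X" and q: "q \<in> Z" and pq: "A *v p + B *v q = c"
    using feasible by blast
  obtain f' where f': "\<And>u. GDERIV f u :> f' u" and f'c: "continuous_on UNIV f'"
    using assms(8) by (auto simp: continuously_differentiable_def)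
  obtain g' where g': "\<And>u. GDERIV g u :> g' u" and g'c: "continuous_on UNIV g'"
    using assms(9) by (auto simp: continuously_differentiable_def)
  have A: "bounded_linear ((*v) A)" and B: "bounded_linear ((*v) B)"
    by (rule matrix_vector_mul_bounded_linear)+
  obtain C where C: "\<And>u t. u \<in> X \<Longrightarrow> (p - u) \<bullet> f' u + y t \<bullet> (A *v (p - u)) \<le> C"
    using first_order_term_bounded[OF \<open>compact X\<close> continuous_on_subset[OF f'c subset_UNIV] A \<open>bounded (range y)\<close>]
    by blast
  obtain D where D: "\<And>u t. u \<in> Z \<Longrightarrow> (q - u) \<bullet> g' u + y t \<bullet> (B *v (q - u)) \<le> D"
    using first_order_term_bounded[OF \<open>compact Z\<close> continuous_on_subset[OF g'c subset_UNIV] B \<open>bounded (range y)\<close>]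
    by blast
  \<comment> \<open>Membership holds only from index 1 on, since \<open>adpm\<close> does not place
    \<open>x 0\<close> and \<open>z 0\<close> in the constraint sets.\<close>
  have xX: "x (Suc t) \<in> X" and zZ: "z (Suc t) \<in> Z"
    and xmin: "u \<in> X \<Longrightarrow> aug_lagrangian f g A B c (\<rho> t) (x (Suc t)) (z t) (y t)
                        \<le> aug_lagrangian f g A B c (\<rho> t) u (z t) (y t)"
    and zmin: "v \<in> Z \<Longrightarrow> aug_lagrangian f g A B c (\<rho> t) (x (Suc t)) (z (Suc t)) (y t)
                        \<le> aug_lagrangian f g A B c (\<rho> t) (x (Suc t)) v (y t)" for t u v
    using assms(18) by (auto simp: adpm_def is_arg_min_linorder)
  define r where "r t = norm (A *v x t + B *v z t - c)" for t
  define V where "V t = (norm (B *v z t - B *v q))\<^sup>2" for t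
  \<comment> \<open>\<open>C\<close> and \<open>D\<close> are mere upper bounds and may be negative;
    the absolute values make the error terms nonnegative, as the telescoping bound requires.\<close>
  define E where "E = 2 * \<bar>C\<bar> + 2 * \<bar>D\<bar>"
  have step: "(r (Suc t))\<^sup>2 \<le> V t - V (Suc t) + E * inverse (\<rho> t)" for t
  proof -
    \<comment> \<open>The x-update approximately projects \<open>c - B *v z t\<close> onto the image
      of \<open>X\<close>; the constant \<open>g (z t)\<close> cancels.\<close>
    have "(norm (A *v x (Suc t) - (c - B *v z t)))\<^sup>2 + (norm (A *v x (Suc t) - A *v p))\<^sup>2
        \<le> (norm (A *v p - (c - B *v z t)))\<^sup>2 + 2 * C / \<rho> t"
    proof (rule penalty_min_pythagoras[OF f' A \<open>convex X\<close> xX p assms(20) _ C[OF xX]])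
      fix v assume "v \<in> X"
      from xmin[OF this, of t]
      show "f (x (Suc t)) + y t \<bullet> (A *v x (Suc t) - (c - B *v z t))
              + \<rho> t / 2 * (norm (A *v x (Suc t) - (c - B *v z t)))\<^sup>2
          \<le> f v + y t \<bullet> (A *v v - (c - B *v z t)) + \<rho> t / 2 * (norm (A *v v - (c - B *v z t)))\<^sup>2"
        by (simp add: aug_lagrangian_def diff_diff_eq2)
    qed
    moreover have "A *v p - (c - B *v z t) = B *v z t - B *v q"
      using pq by (auto simp: algebra_simps)
    \<comment> \<open>The first square, the residual between the two updates, is dropped.\<close>
    ultimately have 1: "(norm (A *v x (Suc t) - A *v p))\<^sup>2 \<le> V t + 2 * C / \<rho> t"
      unfolding V_def by (smt (verit) zero_le_power2)
    \<comment> \<open>For the z-update both squares are kept: they are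
      \<open>(r (Suc t))\<^sup>2\<close> and \<open>V (Suc t)\<close>. The square on the right is
      the quantity bounded in \<open>1\<close>.\<close>
    have "(norm (B *v z (Suc t) - (c - A *v x (Suc t))))\<^sup>2 + (norm (B *v z (Suc t) - B *v q))\<^sup>2
        \<le> (norm (B *v q - (c - A *v x (Suc t))))\<^sup>2 + 2 * D / \<rho> t"
    proof (rule penalty_min_pythagoras[OF g' B \<open>convex Z\<close> zZ q assms(20) _ D[OF zZ]])
      fix v assume "v \<in> Z"
      from zmin[OF this, of t]
      show "g (z (Suc t)) + y t \<bullet> (B *v z (Suc t) - (c - A *v x (Suc t)))
              + \<rho> t / 2 * (norm (B *v z (Suc t) - (c - A *v x (Suc t))))\<^sup>2
          \<le> g v + y t \<bullet> (B *v v - (c - A *v x (Suc t)))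
              + \<rho> t / 2 * (norm (B *v v - (c - A *v x (Suc t))))\<^sup>2"
        by (simp add: aug_lagrangian_def diff_diff_eq2 add.commute)
    qed
    moreover have "B *v q - (c - A *v x (Suc t)) = A *v x (Suc t) - A *v p"
      using pq by (auto simp: algebra_simps)
    moreover have "B *v z (Suc t) - (c - A *v x (Suc t)) = A *v x (Suc t) + B *v z (Suc t) - c"
      by (simp add: algebra_simps)
    ultimately have "(r (Suc t))\<^sup>2 + V (Suc t) \<le> V t + 2 * C / \<rho> t + 2 * D / \<rho> t"
      using 1 by (simp add: r_def V_def)
    moreover have "2 * C / \<rho> t + 2 * D / \<rho> t \<le> E * inverse (\<rho> t)"
    proof -
      have "2 * C / \<rho> t + 2 * D / \<rho> t = (2 * C + 2 * D) * inverse (\<rho> t)"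
        by (simp add: divide_inverse distrib_right)
      also have "\<dots> \<le> E * inverse (\<rho> t)"
        using assms(20)[of t] by (intro mult_right_mono) (auto simp: E_def)
      finally show ?thesis .
    qed
    ultimately show ?thesis
      by linarith
  qed
  have "summable (\<lambda>t. inverse (\<rho> t))"
  proof (rule summable_block_contraction)
    show "inverse (\<rho> (t + \<kappa>)) \<le> inverse \<Delta> * inverse (\<rho> t)" for t
      using le_imp_inverse_le[OF assms(24)[of t]] assms(20)[of t] \<open>\<Delta> > 1\<close>
      by (simp add: inverse_mult_distrib)
    show "0 \<le> inverse (\<rho> t)" for t
      using assms(20)[of t] by simp
    show "inverse \<Delta> < 1"
      using \<open>\<Delta> > 1\<close> by (simp add: inverse_less_1_iff)
  qed
  then have "summable (\<lambda>t. E * inverse (\<rho> t))"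
    by (rule summable_mult)
  then have "summable (\<lambda>t. (r (Suc t))\<^sup>2)"
    by (intro summable_telescope_bound[where V = V, OF _ _ _ _ step])
      (auto simp: V_def E_def less_imp_le[OF assms(20)])
  then have "(\<lambda>t. sqrt ((r (Suc t))\<^sup>2)) \<longlonglongrightarrow> sqrt 0"
    by (intro tendsto_real_sqrt summable_LIMSEQ_zero)
  then have "(\<lambda>t. r (Suc t)) \<longlonglongrightarrow> 0"
    by (simp add: r_def)
  \<comment> \<open>The shift back by one index recovers the full sequence, whose term at 0 does not
    affect the limit.\<close>
  then show ?thesis
    unfolding r_def by (rule LIMSEQ_imp_Suc)
qed

end
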